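(* Let $(\mathcal{S}, \mathcal{A}, P, R, \gamma)$ be a Markov Decision Process with finite state space $\mathcal{S}$, finite action space $\mathcal{A}$, transition probabilities $P(\cdot \mid s,a)$ (a probability distribution on $\mathcal{S}$ for every $(s,a) \in \mathcal{S} \times \mathcal{A}$), bounded reward function $R : \mathcal{S} \times \mathcal{A} \to \mathbb{R}$, and discount factor $\gamma \in [0,1)$. Let $g : \mathcal{S} \times \mathcal{A} \to \{0,1\}$ be a safety predicate, and suppose that for every $s \in \mathcal{S}$ the safe action set $\mathcal{A}_{\text{safe}}(s) = \{ a \in \mathcal{A} \mid g(s,a) = 1 \}$ is non-empty. Then the Guarded Bellman Operator $\mathcal{T}_{\Pi}$ is a $\gamma$-contraction in the max norm: for any two bounded functions $Q_1, Q_2 : \mathcal{S} \times \mathcal{A} \to \mathbb{R}$, $$\| \mathcal{T}_{\Pi} Q_1 - \mathcal{T}_{\Pi} Q_2 \|_{\infty} \le \gamma \, \| Q_1 - Q_2 \|_{\infty}.$$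
   Context: The Guarded Bellman Operator $\mathcal{T}_{\Pi}$ maps a function $Q : \mathcal{S} \times \mathcal{A} \to \mathbb{R}$ to the function $\mathcal{T}_{\Pi} Q : \mathcal{S} \times \mathcal{A} \to \mathbb{R}$ defined, for all $(s,a) \in \mathcal{S} \times \mathcal{A}$, by $$(\mathcal{T}_{\Pi} Q)(s,a) = R(s,a) + \gamma \, \mathbb{E}_{s' \sim P(\cdot \mid s,a)} \left[ \max_{a' \in \mathcal{A}_{\text{safe}}(s')} Q(s', a') \right].$$ The max norm of $Q : \mathcal{S} \times \mathcal{A} \to \mathbb{R}$ is $\| Q \|_{\infty} = \max_{(s,a) \in \mathcal{S} \times \mathcal{A}} |Q(s,a)|$. *)

theory Defs
  imports "HOL-Probability.Probability"
begin

text \<open>The state space and the action space are types of class \<open>finite\<close>.  The transition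
  distribution \<open>P(\<sqdot> | s,a)\<close> is the \<open>pmf\<close> \<open>P (s, a)\<close>.\<close>

definition safe_actions :: "('s \<times> 'a \<Rightarrow> nat) \<Rightarrow> 's \<Rightarrow> 'a set" where
  "safe_actions g s = {a. g (s, a) = 1}"

text \<open>\<open>Max\<close> is the genuine maximum below only when \<open>safe_actions g s'\<close> is finite and nonempty.\<close>

definition guarded_bellman ::
  "('s::finite \<times> 'a::finite \<Rightarrow> 's pmf) \<Rightarrow> ('s \<times> 'a \<Rightarrow> real) \<Rightarrow> real \<Rightarrow> ('s \<times> 'a \<Rightarrow> nat) \<Rightarrow>
   ('s \<times> 'a \<Rightarrow> real) \<Rightarrow> ('s \<times> 'a \<Rightarrow> real)" where
  "guarded_bellman P R \<gamma> g Q = (\<lambda>(s, a). R (s, a) +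
     \<gamma> * measure_pmf.expectation (P (s, a)) (\<lambda>s'. MAX a'\<in>safe_actions g s'. Q (s', a')))"

definition max_norm :: "('s::finite \<times> 'a::finite \<Rightarrow> real) \<Rightarrow> real" where
  "max_norm Q = (MAX x\<in>UNIV. \<bar>Q x\<bar>)"

end

theory Submission
  imports Defs
begin

text \<open>The rewards cancel in the difference of the two images, leaving \<open>\<gamma>\<close>
  times a difference of expected maxima. Both operations left are nonexpansive in the sup norm: a
  maximum over a fixed finite nonempty set (\<open>abs_Max_image_diff_le\<close>) and an average
  against a probability distribution (\<open>abs_expectation_diff_le\<close>). The distance between
  \<open>Q1\<close> and \<open>Q2\<close> thus survives both unchanged, and only the factor
  \<open>\<gamma>\<close> shrinks it.\<close>

lemma Max_image_diff_le:
  fixes f h :: "'b \<Rightarrow> real"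
  assumes "finite A" "A \<noteq> {}" and "\<And>x. x \<in> A \<Longrightarrow> f x - h x \<le> c"
  shows "Max (f ` A) - Max (h ` A) \<le> c"
proof -
  have "f x \<le> c + Max (h ` A)" if "x \<in> A" for x
  proof -
    have "h x \<le> Max (h ` A)"
      using assms(1) that by simp
    then show ?thesis
      using assms(3)[OF that] by linarith
  qed
  then have "Max (f ` A) \<le> c + Max (h ` A)"
    using assms(1,2) by simp
  then show ?thesis by simp
qed

text \<open>The one-sided bound is applied twice, with \<open>f\<close> and \<open>h\<close>
  exchanged; the two maxima may be attained at different points.\<close>

lemma abs_Max_image_diff_le:
  fixes f h :: "'b \<Rightarrow> real"
  assumes "finite A" "A \<noteq> {}" and "\<And>x. x \<in> A \<Longrightarrow> \<bar>f x - h x\<bar> \<le> c"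
  shows "\<bar>Max (f ` A) - Max (h ` A)\<bar> \<le> c"
proof -
  have "f x - h x \<le> c" "h x - f x \<le> c" if "x \<in> A" for x
    using assms(3)[OF that] by linarith+
  then show ?thesis
    using Max_image_diff_le[OF assms(1,2), of f h c] Max_image_diff_le[OF assms(1,2), of h f c]
    by (simp add: abs_le_iff)
qed

lemma abs_expectation_diff_le:
  fixes p :: "'b::finite pmf" and f h :: "'b \<Rightarrow> real"
  assumes "\<And>x. \<bar>f x - h x\<bar> \<le> c"
  shows "\<bar>measure_pmf.expectation p f - measure_pmf.expectation p h\<bar> \<le> c"
proof -
  \<comment> \<open>The type is finite, so the support of \<open>p\<close> is too. Integrability is
    what allows the difference to move under the integral and monotonicity to apply.\<close>
  have int: "integrable (measure_pmf p) k" for k :: "'b \<Rightarrow> real"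
    by (rule integrable_measure_pmf_finite) simp
  have "\<bar>measure_pmf.expectation p f - measure_pmf.expectation p h\<bar>
      = \<bar>measure_pmf.expectation p (\<lambda>x. f x - h x)\<bar>"
    using int by simp
  also have "\<dots> \<le> measure_pmf.expectation p (\<lambda>x. \<bar>f x - h x\<bar>)"
    by (rule integral_abs_bound)
  also have "\<dots> \<le> measure_pmf.expectation p (\<lambda>_. c)"
    by (rule integral_mono[OF int int assms])
  finally show ?thesis by simp
qed

lemma abs_le_max_norm: "\<bar>Q x\<bar> \<le> max_norm Q"
  unfolding max_norm_def by (rule Max_ge) auto

lemma max_norm_le:
  assumes "\<And>x. \<bar>Q x\<bar> \<le> c"
  shows "max_norm Q \<le> c"
  unfolding max_norm_def using assms by simp

theorem theorem1:
  fixes P :: "'s::finite \<times> 'a::finite \<Rightarrow> 's pmf"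
    and R :: "'s \<times> 'a \<Rightarrow> real"
    and \<gamma> :: real
    and g :: "'s \<times> 'a \<Rightarrow> nat"
    and Q1 Q2 :: "'s \<times> 'a \<Rightarrow> real"
  assumes "bounded (range R)"
    and "0 \<le> \<gamma>" and "\<gamma> < 1"
    and "range g \<subseteq> {0, 1}"
    and "\<And>s. safe_actions g s \<noteq> {}"
    and "bounded (range Q1)" and "bounded (range Q2)"
  shows "max_norm (\<lambda>x. guarded_bellman P R \<gamma> g Q1 x - guarded_bellman P R \<gamma> g Q2 x)
           \<le> \<gamma> * max_norm (\<lambda>x. Q1 x - Q2 x)"
proof (rule max_norm_le)
  fix x :: "'s \<times> 'a"
  let ?V = "\<lambda>Q s'. MAX a'\<in>safe_actions g s'. Q (s', a')"
  let ?E = "\<lambda>Q. measure_pmf.expectation (P x) (?V Q)"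
  \<comment> \<open>Safety enters here: a nonempty safe set makes \<open>Max\<close> a genuine
    maximum. The bound is uniform in \<open>s'\<close>, as averaging over successors
    requires.\<close>
  have "\<bar>?V Q1 s' - ?V Q2 s'\<bar> \<le> max_norm (\<lambda>x. Q1 x - Q2 x)" for s'
    using assms(5) abs_le_max_norm[of "\<lambda>x. Q1 x - Q2 x"]
    by (intro abs_Max_image_diff_le) auto
  then have "\<bar>?E Q1 - ?E Q2\<bar> \<le> max_norm (\<lambda>x. Q1 x - Q2 x)"
    by (rule abs_expectation_diff_le)
  then have "\<gamma> * \<bar>?E Q1 - ?E Q2\<bar> \<le> \<gamma> * max_norm (\<lambda>x. Q1 x - Q2 x)"
    using assms(2) by (rule mult_left_mono)
  \<comment> \<open>The term \<open>R x\<close> is common to both sides and drops out; splitting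
    \<open>x\<close> exposes the pair on which the operator is defined.\<close>
  moreover have "guarded_bellman P R \<gamma> g Q1 x - guarded_bellman P R \<gamma> g Q2 x = \<gamma> * (?E Q1 - ?E Q2)"
    by (cases x) (simp add: guarded_bellman_def right_diff_distrib)
  ultimately show "\<bar>guarded_bellman P R \<gamma> g Q1 x - guarded_bellman P R \<gamma> g Q2 x\<bar>
      \<le> \<gamma> * max_norm (\<lambda>x. Q1 x - Q2 x)"
    using assms(2) by (simp add: abs_mult)
qed

end
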